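(* There exists a universal constant $C\in(0,\infty)$ such that for every $n\in\mathbb N$, every $p\in(2,\infty)$ and every $x_1,\ldots,x_n\in\ell_p$ there exist $y_1,\ldots,y_n\in\ell_2$ such that $$\forall\, i,j\in\{1,\ldots,n\},\qquad \|y_i-y_j\|_{\ell_2}\le C\,p\,\|x_i-x_j\|_{\ell_p},$$ and $$\sum_{i=1}^n\sum_{j=1}^n\|y_i-y_j\|_{\ell_2}^2=\sum_{i=1}^n\sum_{j=1}^n\|x_i-x_j\|_{\ell_p}^2 .$$
   Context: $\ell_p$ is the usual Banach space of $p$-summable sequences. *)

theory Defs
  imports "HOL-Analysis.Analysis"
begin

(* The real sequence space l_p, as a carrier set inside the type of all real sequences.
   lp_norm p is only meaningful on lp_space p, since suminf is unspecified on divergent series. *)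

definition lp_space :: "real \<Rightarrow> (nat \<Rightarrow> real) set" where
  "lp_space p = {x. summable (\<lambda>k. \<bar>x k\<bar> powr p)}"

definition lp_norm :: "real \<Rightarrow> (nat \<Rightarrow> real) \<Rightarrow> real" where
  "lp_norm p x = (\<Sum>k. \<bar>x k\<bar> powr p) powr (1 / p)"

end

theory Submission
  imports Defs
begin

text \<open>
  Subtract the mean of the points, so that \<open>\<Sum>i. z i = 0\<close>, and take for \<open>y i\<close> the image of \<open>z i\<close>
  under the homogeneous Mazur map \<open>M z = r |u|^(p/2) sgn u\<close>, where \<open>r = \<parallel>z\<parallel>\<close> and \<open>u = z / r\<close>. It is
  Lipschitz from lp to l2 with constant of order \<open>p\<close>. With the duality map
  \<open>J z = r |u|^(p-1) sgn u\<close>, centring gives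
  \<open>(\<Sum>i j. \<langle>J (z i) - J (z j), z i - z j\<rangle>) = 2 n (\<Sum>i. \<parallel>z i\<parallel>\<^sup>2) \<ge> (\<Sum>i j. \<parallel>z i - z j\<parallel>\<^sup>2) / 2\<close>,
  while AM-GM applied in each coordinate yields
  \<open>\<langle>J z - J w, z - w\<rangle> \<le> 2 \<parallel>M z - M w\<parallel>\<^sup>2\<close>. Rescaling by a factor of at
  most \<open>2\<close> turns the resulting inequality between the two sums of squares into an equality.
\<close>

subsection \<open>Sequence spaces\<close>

text \<open>Convexity in the interior; when \<open>x\<close> or \<open>y\<close> is 0 it reduces to
  \<open>c powr p \<le> c\<close> for \<open>c\<close> in [0,1].\<close>

lemma convex_powr_nonneg:
  fixes s t x y p :: real
  assumes p: "1 \<le> p" and st: "0 \<le> s" "0 \<le> t" "s + t = 1" and xy: "0 \<le> x" "0 \<le> y"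
  shows "(s * x + t * y) powr p \<le> s * x powr p + t * y powr p"
proof -
  have one: "c powr p \<le> c" if "0 \<le> c" "c \<le> 1" for c :: real
    using powr_mono'[of 1 p c] that p by simp
  consider "x = 0" | "y = 0" | "0 < x" "0 < y" using xy by linarith
  then show ?thesis
  proof cases
    case 1
    have "t powr p * y powr p \<le> t * y powr p" using one[of t] st by (intro mult_right_mono) auto
    then show ?thesis using 1 p by (simp add: powr_mult)
  next
    case 2
    have "s powr p * x powr p \<le> s * x powr p" using one[of s] st by (intro mult_right_mono) auto
    then show ?thesis using 2 p by (simp add: powr_mult)
  next
    case 3
    have "1 - t = s" using st by simp
    moreover have "((1 - t) *\<^sub>R x + t *\<^sub>R y) powr p \<le> (1 - t) * x powr p + t * y powr p"
      using 3 st by (intro convex_onD[OF powr_convex[OF p]]) auto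
    ultimately show ?thesis by simp
  qed
qed

lemma lp_norm_nonneg: "0 \<le> lp_norm p x"
  by (simp add: lp_norm_def)

lemma lp_norm_powr:
  assumes "0 < p" "x \<in> lp_space p"
  shows "lp_norm p x powr p = (\<Sum>k. \<bar>x k\<bar> powr p)"
proof -
  have "0 \<le> (\<Sum>k. \<bar>x k\<bar> powr p)"
    using assms by (intro suminf_nonneg) (auto simp: lp_space_def)
  then show ?thesis using assms by (simp add: lp_norm_def powr_powr)
qed

lemma lp_norm_sums:
  assumes "0 < p" "x \<in> lp_space p"
  shows "(\<lambda>k. \<bar>x k\<bar> powr p) sums (lp_norm p x powr p)"
  using assms by (simp add: lp_norm_powr lp_space_def summable_sums)

lemma lp_norm_eq_if_sums:
  assumes "0 < p" "0 \<le> r" "(\<lambda>k. \<bar>x k\<bar> powr p) sums (r powr p)"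
  shows "lp_norm p x = r"
  using assms(1,2) by (simp add: lp_norm_def powr_powr sums_unique[OF assms(3), symmetric])

lemma lp_norm_le_if_sums:
  assumes "0 < p" "0 \<le> r" "\<And>k. \<bar>x k\<bar> powr p \<le> f k" "f sums (r powr p)"
  shows "x \<in> lp_space p" "lp_norm p x \<le> r"
proof -
  have s: "summable (\<lambda>k. \<bar>x k\<bar> powr p)"
    by (rule summable_comparison_test'[OF sums_summable[OF assms(4)], of 0]) (use assms in auto)
  then show x: "x \<in> lp_space p" by (simp add: lp_space_def)
  have "lp_norm p x powr p \<le> r powr p"
    using sums_le[OF assms(3) lp_norm_sums[OF assms(1) x] assms(4)] .
  then show "lp_norm p x \<le> r"
    using assms lp_norm_nonneg[of p x] powr_less_mono2[of p r "lp_norm p x"] by linarith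
qed

lemma lp_space_scale:
  assumes "0 < p" "x \<in> lp_space p"
  shows "(\<lambda>k. c * x k) \<in> lp_space p"
  using assms by (auto simp: lp_space_def abs_mult powr_mult intro: summable_mult)

lemma lp_norm_scale:
  assumes "0 < p" "x \<in> lp_space p"
  shows "lp_norm p (\<lambda>k. c * x k) = \<bar>c\<bar> * lp_norm p x"
proof (rule lp_norm_eq_if_sums[OF assms(1)])
  show "(\<lambda>k. \<bar>c * x k\<bar> powr p) sums ((\<bar>c\<bar> * lp_norm p x) powr p)"
    using sums_mult[OF lp_norm_sums[OF assms], of "\<bar>c\<bar> powr p"]
    by (simp add: abs_mult powr_mult)
qed (simp add: lp_norm_nonneg)

lemma lp_norm_eq_0D:
  assumes "0 < p" "x \<in> lp_space p" "lp_norm p x = 0"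
  shows "x k = 0"
proof -
  have "(\<Sum>k. \<bar>x k\<bar> powr p) = 0"
    using lp_norm_powr[OF assms(1,2)] assms(1,3) by simp
  then have "\<forall>k. \<bar>x k\<bar> powr p = 0"
    using assms(2) by (subst (asm) suminf_eq_zero_iff) (auto simp: lp_space_def)
  then show ?thesis by simp
qed

lemma lp_minus_commute: "lp_norm p (\<lambda>k. x k - y k) = lp_norm p (\<lambda>k. y k - x k)"
  by (simp add: lp_norm_def abs_minus_commute)

text \<open>Minkowski's inequality from convexity alone: after division by \<open>a + b\<close>, the
  sum is dominated by a convex combination of the normalized sequences, with weights proportional to
  the two norms.\<close>

lemma lp_add:
  assumes p: "1 \<le> p" and x: "x \<in> lp_space p" and y: "y \<in> lp_space p"
  shows "(\<lambda>k. x k + y k) \<in> lp_space p" "lp_norm p (\<lambda>k. x k + y k) \<le> lp_norm p x + lp_norm p y"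
proof -
  have "(\<lambda>k. x k + y k) \<in> lp_space p \<and> lp_norm p (\<lambda>k. x k + y k) \<le> lp_norm p x + lp_norm p y"
  proof (cases "lp_norm p x = 0 \<or> lp_norm p y = 0")
    case True
    then have "x = (\<lambda>_. 0) \<or> y = (\<lambda>_. 0)" using lp_norm_eq_0D x y p by (metis ext less_le_trans zero_less_one)
    then show ?thesis using x y by (auto simp: lp_norm_nonneg)
  next
    case False
    define a b where "a = lp_norm p x" and "b = lp_norm p y"
    have ab: "0 < a" "0 < b" using False lp_norm_nonneg[of p x] lp_norm_nonneg[of p y]
      by (auto simp: a_def b_def)
    define s t where "s = a / (a + b)" and "t = b / (a + b)"
    have st: "0 < s" "0 < t" "s + t = 1" using ab by (auto simp: s_def t_def simp flip: add_divide_distrib)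
    \<comment> \<open>The majorant is summable termwise: each normalized sequence contributes 1 and
      the weights add up to 1, so the total is \<open>(a + b) powr p\<close>.\<close>
    define f where "f k = (a + b) powr p * (s * (\<bar>x k\<bar> / a) powr p + t * (\<bar>y k\<bar> / b) powr p)" for k
    have le: "\<bar>x k + y k\<bar> powr p \<le> f k" for k
    proof -
      have "\<bar>x k + y k\<bar> \<le> (a + b) * (s * (\<bar>x k\<bar> / a) + t * (\<bar>y k\<bar> / b))"
        using ab by (simp add: s_def t_def distrib_left abs_triangle_ineq)
      then have "\<bar>x k + y k\<bar> powr p \<le> ((a + b) * (s * (\<bar>x k\<bar> / a) + t * (\<bar>y k\<bar> / b))) powr p"
        using p by (intro powr_mono2) auto
      also have "\<dots> \<le> f k"
        unfolding f_def powr_mult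
        using ab st p by (intro mult_left_mono convex_powr_nonneg) auto
      finally show ?thesis .
    qed
    have "f sums ((a + b) powr p * (s * (a powr p / a powr p) + t * (b powr p / b powr p)))"
      unfolding f_def powr_divide a_def b_def
      using x y p by (intro sums_mult sums_add sums_divide lp_norm_sums) auto
    then have "f sums ((a + b) powr p)" using ab st by simp
    from lp_norm_le_if_sums[OF _ _ le this] show ?thesis using p ab by (auto simp: a_def b_def)
  qed
  then show "(\<lambda>k. x k + y k) \<in> lp_space p" "lp_norm p (\<lambda>k. x k + y k) \<le> lp_norm p x + lp_norm p y"
    by auto
qed

lemma lp_diff:
  assumes p: "1 \<le> p" and x: "x \<in> lp_space p" and y: "y \<in> lp_space p"
  shows "(\<lambda>k. x k - y k) \<in> lp_space p" "lp_norm p (\<lambda>k. x k - y k) \<le> lp_norm p x + lp_norm p y"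
  using lp_add[OF p x lp_space_scale[OF _ y, of "-1"]] lp_norm_scale[OF _ y, of "-1"] p by auto

lemma lp_norm_diff_ge:
  assumes p: "1 \<le> p" and x: "x \<in> lp_space p" and y: "y \<in> lp_space p"
  shows "\<bar>lp_norm p x - lp_norm p y\<bar> \<le> lp_norm p (\<lambda>k. x k - y k)"
  using lp_add(2)[OF p lp_diff(1)[OF p x y] y] lp_add(2)[OF p lp_diff(1)[OF p y x] x]
    lp_minus_commute[of p x y] by auto

lemma lp_space_sum:
  assumes p: "1 \<le> p" and "finite I" "\<And>i. i \<in> I \<Longrightarrow> x i \<in> lp_space p"
  shows "(\<lambda>k. \<Sum>i\<in>I. x i k) \<in> lp_space p"
  using assms(2,3)
proof (induction I rule: finite_induct)
  case empty
  then show ?case using p by (simp add: lp_space_def)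
next
  case (insert i I)
  then show ?case using lp_add(1)[OF p] by simp
qed

lemma l2_iff_summable: "x \<in> lp_space 2 \<longleftrightarrow> summable (\<lambda>k. (x k)\<^sup>2)"
  by (simp add: lp_space_def)

lemma l2_norm_sums: "x \<in> lp_space 2 \<Longrightarrow> (\<lambda>k. (x k)\<^sup>2) sums (lp_norm 2 x)\<^sup>2"
  using lp_norm_sums[of 2 x] lp_norm_nonneg[of 2 x] by simp

subsection \<open>Signed powers\<close>

text \<open>Exponent \<open>p / 2\<close> gives the coordinates of the Mazur map, exponent
  \<open>p - 1\<close> those of the duality map.\<close>

definition spow :: "real \<Rightarrow> real \<Rightarrow> real" where
  "spow q t = sgn t * \<bar>t\<bar> powr q"

lemma spow_0 [simp]: "spow q 0 = 0"
  by (simp add: spow_def)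

lemma spow_minus: "spow q (- t) = - spow q t"
  by (simp add: spow_def sgn_minus)

lemma spow_half_square: "(spow (p / 2) t)\<^sup>2 = \<bar>t\<bar> powr p"
  by (cases "t = 0") (auto simp: spow_def power_mult_distrib sgn_if simp flip: powr_add power2_eq_square, simp_all add: power2_eq_square flip: powr_add)

lemma spow_mult_self: "spow (p - 1) t * t = \<bar>t\<bar> powr p"
  by (cases "t = 0") (auto simp: spow_def sgn_if powr_diff)

lemma spow_pos: "0 < t \<Longrightarrow> spow q t = t powr q"
  by (simp add: spow_def)

text \<open>For equal signs, AM-GM is used twice: the left side is at least
  \<open>2 * spow (p / 2) a * spow (p / 2) b\<close>, and a second copy of this product is absorbed
  by the two p-th powers. For opposite signs the product is negative and a rearrangement inequality
  suffices.\<close>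

lemma spow_cross_ge:
  assumes p: "2 \<le> p"
  shows "spow (p - 1) a * b + spow (p - 1) b * a
    \<ge> 4 * spow (p / 2) a * spow (p / 2) b - \<bar>a\<bar> powr p - \<bar>b\<bar> powr p"
proof -
  have pos: "u powr (p - 1) * v + v powr (p - 1) * u \<ge> 2 * u powr (p / 2) * v powr (p / 2)"
    if "0 < u" "0 < v" for u v :: real
  proof -
    \<comment> \<open>Square roots of the two summands, arranged so that the product
      \<open>A * B\<close> is symmetric in \<open>u\<close> and \<open>v\<close>.\<close>
    define A B where "A = u powr ((p - 1) / 2) * v powr (1 / 2)"
      and "B = u powr (1 / 2) * v powr ((p - 1) / 2)"
    have sq: "A\<^sup>2 = u powr (p - 1) * v" "B\<^sup>2 = v powr (p - 1) * u"
      using that by (auto simp: A_def B_def power_mult_distrib powr_half_sqrt_powr simp flip: powr_numeral powr_powr)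
        (simp_all add: powr_powr)
    have half: "w powr ((p - 1) / 2) * w powr (1 / 2) = w powr (p / 2)" for w :: real
      by (simp add: diff_divide_distrib flip: powr_add)
    have "A * B = (u powr ((p - 1) / 2) * u powr (1 / 2)) * (v powr ((p - 1) / 2) * v powr (1 / 2))"
      by (simp only: A_def B_def mult_ac)
    then have AB: "A * B = u powr (p / 2) * v powr (p / 2)"
      by (simp only: half)
    have "2 * (A * B) \<le> A\<^sup>2 + B\<^sup>2"
      using sum_squares_bound[of A B] by (simp add: mult.assoc)
    then show ?thesis unfolding sq AB by (simp only: mult.assoc)
  qed
  have mix: "u powr (p - 1) * v + v powr (p - 1) * u \<le> u powr p + v powr p"
    if "0 < u" "0 < v" for u v :: real
  proof -
    have "0 \<le> (u powr (p - 1) - v powr (p - 1)) * (u - v)"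
      using that p powr_mono2[of "p - 1" u v] powr_mono2[of "p - 1" v u]
      by (cases "u \<le> v") (auto intro: mult_nonpos_nonpos)
    moreover have "w powr p = w powr (p - 1) * w" if "0 < w" for w :: real
      using that by (simp add: powr_diff)
    ultimately show ?thesis using that by (simp add: algebra_simps)
  qed
  have sq: "2 * u powr (p / 2) * v powr (p / 2) \<le> u powr p + v powr p" for u v :: real
    using sum_squares_bound[of "u powr (p / 2)" "v powr (p / 2)"]
    by (simp add: power2_eq_square flip: powr_add)
  have nn: "0 \<le> u powr (p / 2) * v powr (p / 2)" for u v :: real
    by simp
  consider "a = 0" | "b = 0" | "0 < a" "0 < b" | "a < 0" "b < 0" | "0 < a" "b < 0" | "a < 0" "0 < b"
    by linarith
  then show ?thesis
  proof cases
    case 3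
    then show ?thesis using pos[of a b] sq[of a b] by (simp add: spow_pos)
  next
    case 4
    then show ?thesis using pos[of "-a" "-b"] sq[of "-a" "-b"] by (simp add: spow_def)
  next
    case 5
    then show ?thesis using mix[of a "-b"] by (simp add: spow_def) (use nn[of a "-b"] in linarith)
  next
    case 6
    then show ?thesis using mix[of "-a" b] by (simp add: spow_def) (use nn[of "-a" b] in linarith)
  qed auto
qed

text \<open>Mean value theorem when the signs agree. When they differ, the powers add up and each
  satisfies \<open>w powr h \<le> w * max u v powr (h - 1)\<close>, where \<open>u\<close>,
  \<open>v\<close>, \<open>w\<close> denote absolute values; the factor \<open>h\<close> is then to
  spare.\<close>

lemma spow_diff_le:
  assumes h: "1 \<le> h"
  shows "\<bar>spow h a - spow h b\<bar> \<le> h * \<bar>a - b\<bar> * max \<bar>a\<bar> \<bar>b\<bar> powr (h - 1)"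
proof -
  have same: "u powr h - v powr h \<le> h * (u - v) * u powr (h - 1)" if "0 < v" "v < u" for u v :: real
  proof -
    have "\<exists>z. v < z \<and> z < u \<and> u powr h - v powr h = (u - v) * (h * z powr (h - 1))"
      using that by (intro MVT2) (auto intro!: derivative_eq_intros)
    then obtain z where z: "v < z" "z < u" "u powr h - v powr h = (u - v) * (h * z powr (h - 1))"
      by blast
    have "z powr (h - 1) \<le> u powr (h - 1)" using z that h by (intro powr_mono2) auto
    then have "(u - v) * (h * z powr (h - 1)) \<le> (u - v) * (h * u powr (h - 1))"
      using that h by (intro mult_left_mono) auto
    then show ?thesis using z by (simp add: mult_ac)
  qed
  have opp: "u powr h + v powr h \<le> h * (u + v) * max u v powr (h - 1)" if "0 \<le> u" "0 \<le> v" for u v :: real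
  proof -
    have *: "w powr h \<le> w * max u v powr (h - 1)" if "w = u \<or> w = v" for w
    proof -
      have "w * w powr (h - 1) \<le> w * max u v powr (h - 1)"
        using that \<open>0 \<le> u\<close> \<open>0 \<le> v\<close> h by (intro mult_left_mono powr_mono2) auto
      moreover have "w * w powr (h - 1) = w powr h"
        using that \<open>0 \<le> u\<close> \<open>0 \<le> v\<close> by (subst powr_mult_base) auto
      ultimately show ?thesis by simp
    qed
    have "u powr h + v powr h \<le> 1 * ((u + v) * max u v powr (h - 1))"
      using *[of u] *[of v] by (simp add: distrib_right)
    also have "\<dots> \<le> h * ((u + v) * max u v powr (h - 1))"
      using h that by (intro mult_right_mono) auto
    finally show ?thesis by (simp add: mult_ac)
  qed
  have main: "\<bar>spow h u - spow h v\<bar> \<le> h * \<bar>u - v\<bar> * max \<bar>u\<bar> \<bar>v\<bar> powr (h - 1)"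
    if uv: "\<bar>v\<bar> \<le> \<bar>u\<bar>" "0 \<le> u" for u v
  proof -
    consider "v \<le> 0" | "0 < v" "v < u" | "0 < v" "u \<le> v" by linarith
    then show ?thesis
    proof cases
      case 1
      then show ?thesis using opp[of u "-v"] uv by (auto simp: spow_def sgn_if split: if_splits)
    next
      case 2
      then have "v powr h \<le> u powr h" using h by (intro powr_mono2) auto
      then show ?thesis using same[of v u] 2 by (simp add: spow_pos max_def)
    next
      case 3
      then have "u = v" using uv by simp
      then show ?thesis by simp
    qed
  qed
  \<comment> \<open>Oddness of \<open>spow h\<close> removes the sign condition; symmetry in the two
    arguments then removes the order condition.\<close>
  have main': "\<bar>spow h u - spow h v\<bar> \<le> h * \<bar>u - v\<bar> * max \<bar>u\<bar> \<bar>v\<bar> powr (h - 1)"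
    if "\<bar>v\<bar> \<le> \<bar>u\<bar>" for u v
    using main[of v u] main[of "-v" "-u"] that
    by (cases "0 \<le> u") (auto simp: spow_minus abs_minus_commute)
  show ?thesis
    using main'[of b a] main'[of a b] by (cases "\<bar>b\<bar> \<le> \<bar>a\<bar>") (auto simp: abs_minus_commute max.commute)
qed

text \<open>Young's inequality turns Hoelder's inequality into a coordinatewise estimate, which can be
  summed directly.\<close>

lemma spow_half_diff_square_le:
  assumes p: "2 < p" and d: "0 < d"
  shows "(spow (p / 2) a - spow (p / 2) b)\<^sup>2
    \<le> p\<^sup>2 / 4 * d\<^sup>2 * (2 / p * (\<bar>a - b\<bar> powr p / d powr p) + (1 - 2 / p) * (\<bar>a\<bar> powr p + \<bar>b\<bar> powr p))"
proof (cases "a = b")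
  case True
  then show ?thesis using p by simp
next
  case False
  define m where "m = max \<bar>a\<bar> \<bar>b\<bar>"
  have m: "0 < m" using False by (auto simp: m_def)
  have t: "0 < \<bar>a - b\<bar> / d" using False d by simp
  have "(spow (p / 2) a - spow (p / 2) b)\<^sup>2 \<le> (p / 2 * \<bar>a - b\<bar> * m powr (p / 2 - 1))\<^sup>2"
    using power_mono[OF spow_diff_le[of "p / 2" a b], of 2] p by (simp add: m_def)
  also have "\<dots> = p\<^sup>2 / 4 * d\<^sup>2 * ((\<bar>a - b\<bar> / d)\<^sup>2 * m powr (p - 2))"
    using d by (simp add: power_mult_distrib power_divide) (simp add: power2_eq_square flip: powr_add)
  \<comment> \<open>The exponents \<open>2 / p\<close> and \<open>1 - 2 / p\<close> are the weights
    of Hoelder's inequality for \<open>p / 2\<close> and its conjugate. Dividing by \<open>d\<close>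
    first puts both factors on the same scale once \<open>d\<close> is the norm of the difference of
    two unit vectors.\<close>
  also have "(\<bar>a - b\<bar> / d)\<^sup>2 * m powr (p - 2)
      = ((\<bar>a - b\<bar> / d) powr p) powr (2 / p) * (m powr p) powr (1 - 2 / p)"
    using p t by (simp add: powr_powr right_diff_distrib)
  also have "\<dots> \<le> 2 / p * ((\<bar>a - b\<bar> / d) powr p) + (1 - 2 / p) * m powr p"
    using p t m by (intro Youngs_inequality_0) auto
  also have "m powr p \<le> \<bar>a\<bar> powr p + \<bar>b\<bar> powr p"
    by (auto simp: m_def max_def)
  finally show ?thesis using p by (simp add: powr_divide mult_left_mono)
qed

subsection \<open>The homogeneous Mazur map\<close>

text \<open>For \<open>x = 0\<close> the division by zero yields the intended value \<open>0\<close>.\<close>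

definition mazur :: "real \<Rightarrow> (nat \<Rightarrow> real) \<Rightarrow> nat \<Rightarrow> real" where
  "mazur p x = (\<lambda>k. lp_norm p x * spow (p / 2) (x k / lp_norm p x))"

lemma normalized_sums:
  assumes "0 < p" "x \<in> lp_space p" "lp_norm p x \<noteq> 0"
  shows "(\<lambda>k. \<bar>x k / lp_norm p x\<bar> powr p) sums 1"
  using sums_divide[OF lp_norm_sums[OF assms(1,2)], of "lp_norm p x powr p"] assms(3)
  by (simp add: powr_divide lp_norm_nonneg)

text \<open>The free factor \<open>c\<close> serves the squared norm (\<open>c\<close> the norm
  itself) as well as the expansion of a squared difference (\<open>c\<close> a difference of norms).
  If the norm is 0, both sides vanish.\<close>

lemma mazur_sums:
  assumes "0 < p" "x \<in> lp_space p"
  shows "(\<lambda>k. c * (spow (p / 2) (x k / lp_norm p x))\<^sup>2 * lp_norm p x) sums (c * lp_norm p x)"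
proof (cases "lp_norm p x = 0")
  case False
  then show ?thesis
    using sums_mult[OF normalized_sums[OF assms False], of "c * lp_norm p x"]
    by (simp add: spow_half_square mult_ac)
qed simp

lemma mazur_in_l2:
  assumes "0 < p" "x \<in> lp_space p"
  shows "mazur p x \<in> lp_space 2"
  using sums_summable[OF mazur_sums[OF assms, of "lp_norm p x"]]
  by (simp add: l2_iff_summable mazur_def power_mult_distrib power2_eq_square mult_ac)

lemma l2_norm_mazur:
  assumes "0 < p" "x \<in> lp_space p"
  shows "lp_norm 2 (mazur p x) = lp_norm p x"
proof (rule lp_norm_eq_if_sums)
  show "(\<lambda>k. \<bar>mazur p x k\<bar> powr 2) sums (lp_norm p x powr 2)"
    using mazur_sums[OF assms, of "lp_norm p x"] lp_norm_nonneg[of p x]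
    by (simp add: mazur_def power_mult_distrib power2_eq_square mult_ac abs_mult)
qed (simp_all add: lp_norm_nonneg)

section \<open>Lipschitz bound for the Mazur map\<close>

text \<open>Write \<open>x / r - y / s\<close> as \<open>(x - y) / r\<close> plus a multiple of
  \<open>y\<close>; that multiple has norm \<open>(r - s) / r\<close>, which the reverse triangle
  inequality bounds by \<open>d / r\<close>. Hence the factor 2 and the larger norm in the
  denominator.\<close>

lemma lp_normalized_diff_le:
  assumes p: "1 \<le> p" and x: "x \<in> lp_space p" and y: "y \<in> lp_space p"
    and pos: "0 < lp_norm p y" "lp_norm p y \<le> lp_norm p x"
  shows "lp_norm p (\<lambda>k. x k / lp_norm p x - y k / lp_norm p y)
    \<le> 2 * lp_norm p (\<lambda>k. x k - y k) / lp_norm p x"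
proof -
  define r s d where "r = lp_norm p x" and "s = lp_norm p y" and "d = lp_norm p (\<lambda>k. x k - y k)"
  have rs: "0 < s" "s \<le> r" "0 < r" using pos by (auto simp: r_def s_def)
  have d1: "(\<lambda>k. x k - y k) \<in> lp_space p" by (rule lp_diff[OF p x y])
  have "(\<lambda>k. x k / r - y k / s) = (\<lambda>k. inverse r * (x k - y k) + (inverse r - inverse s) * y k)"
    by (auto simp: algebra_simps divide_inverse)
  then have "lp_norm p (\<lambda>k. x k / r - y k / s) \<le> \<bar>inverse r\<bar> * d + \<bar>inverse r - inverse s\<bar> * s"
    using lp_add(2)[OF p lp_space_scale[OF _ d1] lp_space_scale[OF _ y], of "inverse r" "inverse r - inverse s"]
      lp_norm_scale[OF _ d1, of "inverse r"] lp_norm_scale[OF _ y, of "inverse r - inverse s"] p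
    by (simp add: d_def s_def)
  also have "\<bar>inverse r - inverse s\<bar> * s = (r - s) / r"
    using rs by (simp add: abs_if field_simps)
  also have "\<dots> \<le> d / r"
    using lp_norm_diff_ge[OF p x y] rs by (simp add: d_def r_def s_def divide_right_mono)
  finally show ?thesis using rs by (simp add: r_def s_def d_def field_simps)
qed

text \<open>Sum the Young estimate with \<open>d\<close> the distance of the unit vectors: the
  bracket totals \<open>2 / p + (1 - 2 / p) * 2\<close>, which is at most 2. The case
  \<open>d = 0\<close> is separate because \<open>d\<close> is a divisor.\<close>

lemma spow_half_sphere_sums_le:
  assumes p: "2 < p" and u: "(\<lambda>k. \<bar>u k\<bar> powr p) sums 1" and v: "(\<lambda>k. \<bar>v k\<bar> powr p) sums 1"
  shows "summable (\<lambda>k. (spow (p / 2) (u k) - spow (p / 2) (v k))\<^sup>2)"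
    and "(\<Sum>k. (spow (p / 2) (u k) - spow (p / 2) (v k))\<^sup>2) \<le> p\<^sup>2 / 2 * (lp_norm p (\<lambda>k. u k - v k))\<^sup>2"
proof -
  define d where "d = lp_norm p (\<lambda>k. u k - v k)"
  have uv: "u \<in> lp_space p" "v \<in> lp_space p"
    using u v by (auto simp: lp_space_def sums_iff)
  have w: "(\<lambda>k. u k - v k) \<in> lp_space p" using lp_diff[OF _ uv] p by simp
  have "summable (\<lambda>k. (spow (p / 2) (u k) - spow (p / 2) (v k))\<^sup>2) \<and>
    (\<Sum>k. (spow (p / 2) (u k) - spow (p / 2) (v k))\<^sup>2) \<le> p\<^sup>2 / 2 * d\<^sup>2"
  proof (cases "d = 0")
    case True
    then have "u k - v k = 0" for k using lp_norm_eq_0D[OF _ w, of k] p by (simp add: d_def)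
    then show ?thesis by simp
  next
    case False
    then have d: "0 < d" using lp_norm_nonneg by (simp add: d_def less_le)
    define f where "f k = p\<^sup>2 / 4 * d\<^sup>2 * (2 / p * (\<bar>u k - v k\<bar> powr p / d powr p)
      + (1 - 2 / p) * (\<bar>u k\<bar> powr p + \<bar>v k\<bar> powr p))" for k
    have "f sums (p\<^sup>2 / 4 * d\<^sup>2 * (2 / p * (d powr p / d powr p) + (1 - 2 / p) * (1 + 1)))"
      unfolding f_def d_def using p w by (intro sums_mult sums_add sums_divide u v lp_norm_sums) auto
    then have f: "f sums (p\<^sup>2 / 4 * d\<^sup>2 * (2 / p + (1 - 2 / p) * 2))" using d by simp
    have le: "(spow (p / 2) (u k) - spow (p / 2) (v k))\<^sup>2 \<le> f k" for k
      unfolding f_def by (rule spow_half_diff_square_le[OF p d])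
    have sm: "summable (\<lambda>k. (spow (p / 2) (u k) - spow (p / 2) (v k))\<^sup>2)"
      by (rule summable_comparison_test'[OF sums_summable[OF f], of 0]) (use le in auto)
    have "(\<Sum>k. (spow (p / 2) (u k) - spow (p / 2) (v k))\<^sup>2) \<le> p\<^sup>2 / 4 * d\<^sup>2 * (2 / p + (1 - 2 / p) * 2)"
      using sums_le[OF le summable_sums[OF sm] f] .
    also have "\<dots> \<le> p\<^sup>2 / 4 * d\<^sup>2 * 2"
      using p by (intro mult_left_mono) (auto simp: field_simps)
    finally show ?thesis using sm by (simp add: mult.commute)
  qed
  then show "summable (\<lambda>k. (spow (p / 2) (u k) - spow (p / 2) (v k))\<^sup>2)"
    and "(\<Sum>k. (spow (p / 2) (u k) - spow (p / 2) (v k))\<^sup>2) \<le> p\<^sup>2 / 2 * (lp_norm p (\<lambda>k. u k - v k))\<^sup>2"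
    by (auto simp: d_def)
qed

text \<open>Split into radial and angular parts: for unit vectors \<open>a\<close>, \<open>b\<close>
  of l2, the squared norm of \<open>r a - s b\<close> is the square of \<open>r - s\<close> plus
  \<open>r s\<close> times the squared norm of \<open>a - b\<close>.\<close>

lemma mazur_lipschitz:
  assumes p: "2 < p" and x: "x \<in> lp_space p" and y: "y \<in> lp_space p"
  shows "lp_norm 2 (\<lambda>k. mazur p x k - mazur p y k) \<le> 3 / 2 * p * lp_norm p (\<lambda>k. x k - y k)"
proof -
  have main: "lp_norm 2 (\<lambda>k. mazur p x k - mazur p y k) \<le> 3 / 2 * p * lp_norm p (\<lambda>k. x k - y k)"
    if x: "x \<in> lp_space p" and y: "y \<in> lp_space p" and le: "lp_norm p y \<le> lp_norm p x" for x y
  proof -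
    define r s d where "r = lp_norm p x" and "s = lp_norm p y" and "d = lp_norm p (\<lambda>k. x k - y k)"
    have nn: "0 \<le> r" "0 \<le> s" "0 \<le> d" by (simp_all add: r_def s_def d_def lp_norm_nonneg)
    have rs: "\<bar>r - s\<bar> \<le> d" using lp_norm_diff_ge[OF _ x y] p by (simp add: r_def s_def d_def)
    have "lp_norm 2 (\<lambda>k. mazur p x k - mazur p y k) \<le> 3 / 2 * p * d"
    proof (cases "s = 0")
      case True
      then have "mazur p y = (\<lambda>_. 0)" by (simp add: mazur_def s_def)
      then have "lp_norm 2 (\<lambda>k. mazur p x k - mazur p y k) = r"
        using l2_norm_mazur[OF _ x] p by (simp add: r_def)
      also have "\<dots> \<le> 1 * d" using rs True by simp
      also have "\<dots> \<le> 3 / 2 * p * d" using p nn by (intro mult_right_mono) auto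
      finally show ?thesis .
    next
      case False
      then have s: "0 < s" "s \<le> r" "0 < r" using nn le by (auto simp: r_def s_def)
      define a b where "a k = spow (p / 2) (x k / r)" and "b k = spow (p / 2) (y k / s)" for k
      have ux: "(\<lambda>k. \<bar>x k / r\<bar> powr p) sums 1" and uy: "(\<lambda>k. \<bar>y k / s\<bar> powr p) sums 1"
        using normalized_sums[OF _ x] normalized_sums[OF _ y] p s by (auto simp: r_def s_def)
      define e where "e = (\<Sum>k. (a k - b k)\<^sup>2)"
      have e: "(\<lambda>k. (a k - b k)\<^sup>2) sums e"
        using spow_half_sphere_sums_le(1)[OF p ux uy] by (simp add: e_def a_def b_def summable_sums)
      have "lp_norm p (\<lambda>k. x k / r - y k / s) \<le> 2 * d / r"
        using lp_normalized_diff_le[OF _ x y] p s by (simp add: r_def s_def d_def)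
      then have "p\<^sup>2 / 2 * (lp_norm p (\<lambda>k. x k / r - y k / s))\<^sup>2 \<le> p\<^sup>2 / 2 * (2 * d / r)\<^sup>2"
        by (intro mult_left_mono power_mono) (auto simp: lp_norm_nonneg)
      then have e_le: "e \<le> p\<^sup>2 / 2 * (2 * d / r)\<^sup>2"
        using spow_half_sphere_sums_le(2)[OF p ux uy] by (simp add: e_def a_def b_def)
      \<comment> \<open>The radial-angular splitting in one coordinate; after summation the first
        two terms combine to the square of \<open>r - s\<close>.\<close>
      have eq: "(mazur p x k - mazur p y k)\<^sup>2
        = (r - s) * (a k)\<^sup>2 * r + (s - r) * (b k)\<^sup>2 * s + r * s * (a k - b k)\<^sup>2" for k
        unfolding mazur_def a_def b_def r_def s_def by (simp add: power2_eq_square algebra_simps)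
      have "(\<lambda>k. (mazur p x k - mazur p y k)\<^sup>2) sums ((r - s) * r + (s - r) * s + r * s * e)"
        unfolding eq
        using mazur_sums[OF _ x, of "r - s"] mazur_sums[OF _ y, of "s - r"] p
        by (intro sums_add sums_mult e) (auto simp: a_def b_def r_def s_def)
      moreover have "(\<lambda>k. (mazur p x k - mazur p y k)\<^sup>2) sums (lp_norm 2 (\<lambda>k. mazur p x k - mazur p y k))\<^sup>2"
        using lp_diff(1)[OF _ mazur_in_l2[OF _ x] mazur_in_l2[OF _ y]] p by (intro l2_norm_sums) auto
      ultimately have "(lp_norm 2 (\<lambda>k. mazur p x k - mazur p y k))\<^sup>2 = (r - s) * r + (s - r) * s + r * s * e"
        by (rule sums_unique2[symmetric])
      also have "\<dots> = (r - s)\<^sup>2 + r * s * e" by (simp add: power2_eq_square algebra_simps)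
      finally have norm_eq: "(lp_norm 2 (\<lambda>k. mazur p x k - mazur p y k))\<^sup>2 = (r - s)\<^sup>2 + r * s * e" .
      \<comment> \<open>Since \<open>s \<le> r\<close>, replacing \<open>s\<close> by
        \<open>r\<close> produces the square that cancels the denominator of the normalized
        distance.\<close>
      have "r * s * e \<le> r * r * (p\<^sup>2 / 2 * (2 * d / r)\<^sup>2)"
        using s e_le sums_le[OF _ sums_zero e] by (intro mult_mono) auto
      also have "\<dots> = 2 * p\<^sup>2 * d\<^sup>2" using s by (simp add: power2_eq_square)
      finally have angle: "r * s * e \<le> 2 * p\<^sup>2 * d\<^sup>2" .
      have radial: "(r - s)\<^sup>2 \<le> d\<^sup>2" using rs nn by (simp add: power2_le_iff_abs_le)
      \<comment> \<open>The radial 1 is absorbed as a quarter of the square of \<open>p\<close>, so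
        the total coefficient is 9/4 of it, the square of \<open>3 / 2 * p\<close>.\<close>
      have "4 \<le> p\<^sup>2" using power_mono[of 2 p 2] p by simp
      then have "(1 + 2 * p\<^sup>2) * d\<^sup>2 \<le> (9 / 4 * p\<^sup>2) * d\<^sup>2" by (intro mult_right_mono) auto
      then have "d\<^sup>2 + 2 * p\<^sup>2 * d\<^sup>2 \<le> (3 / 2 * p * d)\<^sup>2"
        by (simp add: power_mult_distrib distrib_right power_divide)
      then have "(lp_norm 2 (\<lambda>k. mazur p x k - mazur p y k))\<^sup>2 \<le> (3 / 2 * p * d)\<^sup>2"
        using norm_eq angle radial by linarith
      then show ?thesis by (rule power2_le_imp_le) (use p nn in simp)
    qed
    then show ?thesis by (simp add: d_def)
  qed
  show ?thesis
    using main[OF x y] main[OF y x] lp_minus_commute[of p x y]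
      lp_minus_commute[of 2 "mazur p x" "mazur p y"]
    by (cases "lp_norm p y \<le> lp_norm p x") auto
qed

section \<open>Lower bound for the averaged squared distances\<close>

text \<open>The last term sums over the coordinates to \<open>- (r - s)\<^sup>2\<close>, hence can be dropped after summation; it
  is what makes the estimate true in each coordinate.\<close>

lemma duality_mazur_le:
  assumes p: "2 \<le> p" and rs: "0 \<le> r" "0 \<le> s"
  shows "(r * spow (p - 1) u - s * spow (p - 1) v) * (r * u - s * v)
    \<le> 2 * (r * spow (p / 2) u - s * spow (p / 2) v)\<^sup>2
      - (r - s) * (r * (spow (p / 2) u)\<^sup>2 - s * (spow (p / 2) v)\<^sup>2)"
proof -
  define a b where "a = spow (p / 2) u" and "b = spow (p / 2) v"
  \<comment> \<open>After expansion both sides share the same diagonal terms, and only this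
    comparison of the terms with factor \<open>r * s\<close> remains.\<close>
  have "r * s * (4 * a * b - a\<^sup>2 - b\<^sup>2) \<le> r * s * (spow (p - 1) u * v + spow (p - 1) v * u)"
    using spow_cross_ge[OF p, of u v] rs
    by (intro mult_left_mono) (auto simp: a_def b_def spow_half_square)
  moreover have "spow (p - 1) u * u = a\<^sup>2" "spow (p - 1) v * v = b\<^sup>2"
    by (simp_all add: a_def b_def spow_half_square spow_mult_self)
  moreover have "(r * spow (p - 1) u - s * spow (p - 1) v) * (r * u - s * v)
    = r\<^sup>2 * (spow (p - 1) u * u) + s\<^sup>2 * (spow (p - 1) v * v)
      - r * s * (spow (p - 1) u * v + spow (p - 1) v * u)"
    by (simp add: power2_eq_square algebra_simps)
  moreover have "2 * (r * a - s * b)\<^sup>2 - (r - s) * (r * a\<^sup>2 - s * b\<^sup>2)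
    = r\<^sup>2 * a\<^sup>2 + s\<^sup>2 * b\<^sup>2 - r * s * (4 * a * b - a\<^sup>2 - b\<^sup>2)"
    by (simp add: power2_eq_square algebra_simps)
  ultimately show ?thesis by (simp add: a_def b_def)
qed

text \<open>The mixed terms factor and vanish, leaving two diagonal copies. Only \<open>g\<close> is
  centred: \<open>f\<close> will be a coordinate of the duality images, whose sum is
  unrestricted.\<close>

lemma double_sum_mult_diff:
  fixes f g :: "'a \<Rightarrow> real"
  assumes "(\<Sum>i\<in>I. g i) = 0"
  shows "(\<Sum>i\<in>I. \<Sum>j\<in>I. (f i - f j) * (g i - g j)) = 2 * of_nat (card I) * (\<Sum>i\<in>I. f i * g i)"
proof -
  have "(\<Sum>i\<in>I. \<Sum>j\<in>I. f i * g j) = 0" "(\<Sum>i\<in>I. \<Sum>j\<in>I. f j * g i) = 0"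
    using assms by (simp_all flip: sum_distrib_left sum_distrib_right)
  then show ?thesis
    by (simp add: algebra_simps sum.distrib sum_subtractf sum_distrib_left)
qed

text \<open>The duality pairing is summed over all pairs inside each coordinate, giving
  \<open>L k \<le> F k\<close>, and only then over \<open>k\<close>. Thus the duality map enters
  through single coordinates and no dual space appears.\<close>

lemma centred_mazur_sum_ge:
  assumes p: "2 < p" and I: "finite I" and z: "\<And>i. i \<in> I \<Longrightarrow> z i \<in> lp_space p"
    and centred: "\<And>k. (\<Sum>i\<in>I. z i k) = 0"
  shows "of_nat (card I) * (\<Sum>i\<in>I. (lp_norm p (z i))\<^sup>2)
    \<le> (\<Sum>i\<in>I. \<Sum>j\<in>I. (lp_norm 2 (\<lambda>k. mazur p (z i) k - mazur p (z j) k))\<^sup>2)"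
proof -
  define r where "r i = lp_norm p (z i)" for i
  define u where "u i k = z i k / r i" for i k
  define D where "D i j = (lp_norm 2 (\<lambda>k. mazur p (z i) k - mazur p (z j) k))\<^sup>2" for i j
  define A where "A i k = r i * (spow (p / 2) (u i k))\<^sup>2" for i k
  \<comment> \<open>If \<open>r i = 0\<close>, division by zero makes \<open>u i k\<close> zero, and
    \<open>z i k\<close> vanishes as well.\<close>
  have ru: "r i * u i k = z i k" if "i \<in> I" for i k
    using lp_norm_eq_0D[OF _ z[OF that], of k] p by (auto simp: u_def r_def)
  have A: "A i sums r i" if "i \<in> I" for i
    using mazur_sums[OF _ z[OF that], of 1] p by (simp add: A_def[abs_def] u_def r_def mult.commute)
  have D: "(\<lambda>k. (mazur p (z i) k - mazur p (z j) k)\<^sup>2) sums D i j" if "i \<in> I" "j \<in> I" for i j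
    unfolding D_def using lp_diff(1)[OF _ mazur_in_l2[OF _ z[OF that(1)]] mazur_in_l2[OF _ z[OF that(2)]]] p
    by (intro l2_norm_sums) auto
  define L where "L k = 2 * of_nat (card I) * (\<Sum>i\<in>I. r i * A i k)" for k
  define F where "F k = (\<Sum>i\<in>I. \<Sum>j\<in>I. 2 * (mazur p (z i) k - mazur p (z j) k)\<^sup>2
    - (r i - r j) * (A i k - A j k))" for k
  have "L k \<le> F k" for k
  proof -
    have "r i * A i k = r i * spow (p - 1) (u i k) * z i k" if "i \<in> I" for i
    proof -
      have "r i * A i k = r i * (r i * (spow (p - 1) (u i k) * u i k))"
        by (simp add: A_def spow_half_square spow_mult_self)
      also have "\<dots> = r i * spow (p - 1) (u i k) * (r i * u i k)" by simp
      finally show ?thesis using ru[OF that] by simp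
    qed
    then have "L k = 2 * of_nat (card I) * (\<Sum>i\<in>I. (r i * spow (p - 1) (u i k)) * z i k)"
      unfolding L_def by (simp only: cong: sum.cong)
    also have "\<dots> = (\<Sum>i\<in>I. \<Sum>j\<in>I. (r i * spow (p - 1) (u i k) - r j * spow (p - 1) (u j k)) * (z i k - z j k))"
      by (rule double_sum_mult_diff[OF centred, symmetric])
    also have "\<dots> \<le> F k"
      unfolding F_def
    proof (intro sum_mono)
      fix i j assume "i \<in> I" "j \<in> I"
      then show "(r i * spow (p - 1) (u i k) - r j * spow (p - 1) (u j k)) * (z i k - z j k)
        \<le> 2 * (mazur p (z i) k - mazur p (z j) k)\<^sup>2 - (r i - r j) * (A i k - A j k)"
        using duality_mazur_le[of p "r i" "r j" "u i k" "u j k"] p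
        by (simp add: ru A_def) (simp add: mazur_def u_def r_def lp_norm_nonneg)
    qed
    finally show ?thesis .
  qed
  moreover have "L sums (2 * of_nat (card I) * (\<Sum>i\<in>I. r i * r i))"
    unfolding L_def by (intro sums_mult sums_sum A)
  moreover have "F sums (\<Sum>i\<in>I. \<Sum>j\<in>I. 2 * D i j - (r i - r j) * (r i - r j))"
    unfolding F_def by (intro sums_sum sums_diff sums_mult A D)
  ultimately have "2 * of_nat (card I) * (\<Sum>i\<in>I. r i * r i)
      \<le> (\<Sum>i\<in>I. \<Sum>j\<in>I. 2 * D i j - (r i - r j) * (r i - r j))"
    by (rule sums_le)
  \<comment> \<open>The correction terms have become negated squares of \<open>r i - r j\<close> and
    are dropped.\<close>
  also have "\<dots> \<le> (\<Sum>i\<in>I. \<Sum>j\<in>I. 2 * D i j)"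
    by (intro sum_mono) simp
  also have "\<dots> = 2 * (\<Sum>i\<in>I. \<Sum>j\<in>I. D i j)" by (simp add: sum_distrib_left)
  finally show ?thesis by (simp add: D_def r_def power2_eq_square)
qed

lemma lp_sum_diff_square_le:
  assumes p: "1 \<le> p" and z: "\<And>i. i \<in> I \<Longrightarrow> z i \<in> lp_space p"
  shows "(\<Sum>i\<in>I. \<Sum>j\<in>I. (lp_norm p (\<lambda>k. z i k - z j k))\<^sup>2)
    \<le> 4 * (of_nat (card I) * (\<Sum>i\<in>I. (lp_norm p (z i))\<^sup>2))"
proof -
  have "(lp_norm p (\<lambda>k. z i k - z j k))\<^sup>2 \<le> 2 * (lp_norm p (z i))\<^sup>2 + 2 * (lp_norm p (z j))\<^sup>2"
    if "i \<in> I" "j \<in> I" for i j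
  proof -
    have "(lp_norm p (\<lambda>k. z i k - z j k))\<^sup>2 \<le> (lp_norm p (z i) + lp_norm p (z j))\<^sup>2"
      using lp_diff(2)[OF p z[OF that(1)] z[OF that(2)]] by (simp add: power_mono lp_norm_nonneg)
    also have "\<dots> \<le> 2 * (lp_norm p (z i))\<^sup>2 + 2 * (lp_norm p (z j))\<^sup>2"
      using sum_squares_bound[of "lp_norm p (z i)" "lp_norm p (z j)"] by (simp add: power2_sum)
    finally show ?thesis .
  qed
  then have "(\<Sum>i\<in>I. \<Sum>j\<in>I. (lp_norm p (\<lambda>k. z i k - z j k))\<^sup>2)
      \<le> (\<Sum>i\<in>I. \<Sum>j\<in>I. 2 * (lp_norm p (z i))\<^sup>2 + 2 * (lp_norm p (z j))\<^sup>2)"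
    by (intro sum_mono)
  then show ?thesis by (simp add: sum.distrib flip: sum_distrib_left)
qed

section \<open>Centring and rescaling\<close>

theorem corollary1p6:
  shows "\<exists>C::real. 0 < C \<and>
    (\<forall>(n::nat) (p::real) (x :: nat \<Rightarrow> nat \<Rightarrow> real).
      1 \<le> n \<longrightarrow> 2 < p \<longrightarrow> (\<forall>i\<in>{1..n}. x i \<in> lp_space p) \<longrightarrow>
      (\<exists>y :: nat \<Rightarrow> nat \<Rightarrow> real.
        (\<forall>i\<in>{1..n}. y i \<in> lp_space 2) \<and>
        (\<forall>i\<in>{1..n}. \<forall>j\<in>{1..n}.
          lp_norm 2 (\<lambda>k. y i k - y j k) \<le> C * p * lp_norm p (\<lambda>k. x i k - x j k)) \<and>
        (\<Sum>i=1..n. \<Sum>j=1..n. (lp_norm 2 (\<lambda>k. y i k - y j k))\<^sup>2) =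
        (\<Sum>i=1..n. \<Sum>j=1..n. (lp_norm p (\<lambda>k. x i k - x j k))\<^sup>2)))"
proof (intro exI[of _ 3] conjI allI impI)
  fix n :: nat and p :: real and x :: "nat \<Rightarrow> nat \<Rightarrow> real"
  assume n: "1 \<le> n" and p: "2 < p" and x: "\<forall>i\<in>{1..n}. x i \<in> lp_space p"
  define c where "c k = (1 / real n) * (\<Sum>i=1..n. x i k)" for k
  define z where "z i = (\<lambda>k. x i k - c k)" for i
  have c: "c \<in> lp_space p"
    unfolding c_def using p x by (intro lp_space_scale lp_space_sum) auto
  have z: "z i \<in> lp_space p" if "i \<in> {1..n}" for i
    unfolding z_def using lp_diff(1)[OF _ _ c, of "x i"] p x that by auto
  have centred: "(\<Sum>i=1..n. z i k) = 0" for k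
    using n by (simp add: z_def c_def sum_subtractf)
  define X where "X = (\<Sum>i=1..n. \<Sum>j=1..n. (lp_norm p (\<lambda>k. z i k - z j k))\<^sup>2)"
  define G where "G = (\<Sum>i=1..n. \<Sum>j=1..n. (lp_norm 2 (\<lambda>k. mazur p (z i) k - mazur p (z j) k))\<^sup>2)"
  have XG: "X \<le> 4 * G"
    using lp_sum_diff_square_le[of p "{1..n}" z] centred_mazur_sum_ge[of p "{1..n}" z] p z centred
    by (simp add: X_def G_def)
  have nn: "0 \<le> X" "0 \<le> G" unfolding X_def G_def by (auto intro!: sum_nonneg)
  \<comment> \<open>If \<open>G = 0\<close>, then \<open>XG\<close> forces \<open>X = 0\<close>, and
    the default \<open>t = 0\<close> still satisfies \<open>t\<^sup>2 * G = X\<close>.\<close>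
  define t where "t = sqrt (X / G)"
  have t: "0 \<le> t" "t \<le> 2" "t\<^sup>2 * G = X"
  proof -
    have "X / G \<le> 2\<^sup>2" using XG nn by (cases "G = 0") (auto simp: divide_le_eq)
    then show "t \<le> 2" unfolding t_def by (intro real_le_lsqrt) auto
  qed (use XG nn in \<open>auto simp: t_def\<close>)
  define y where "y i = (\<lambda>k. t * mazur p (z i) k)" for i
  have y: "y i \<in> lp_space 2" if "i \<in> {1..n}" for i
    unfolding y_def using p z[OF that] by (intro lp_space_scale mazur_in_l2) auto
  have yn: "lp_norm 2 (\<lambda>k. y i k - y j k) = t * lp_norm 2 (\<lambda>k. mazur p (z i) k - mazur p (z j) k)"
    if "i \<in> {1..n}" "j \<in> {1..n}" for i j
  proof -
    have "(\<lambda>k. mazur p (z i) k - mazur p (z j) k) \<in> lp_space 2"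
      using p z that by (intro lp_diff(1) mazur_in_l2) auto
    from lp_norm_scale[OF _ this, of t] show ?thesis
      using t by (simp add: y_def right_diff_distrib)
  qed
  have zx: "(\<lambda>k. z i k - z j k) = (\<lambda>k. x i k - x j k)" for i j by (simp add: z_def)
  show "\<exists>y. (\<forall>i\<in>{1..n}. y i \<in> lp_space 2) \<and>
      (\<forall>i\<in>{1..n}. \<forall>j\<in>{1..n}. lp_norm 2 (\<lambda>k. y i k - y j k) \<le> 3 * p * lp_norm p (\<lambda>k. x i k - x j k)) \<and>
      (\<Sum>i=1..n. \<Sum>j=1..n. (lp_norm 2 (\<lambda>k. y i k - y j k))\<^sup>2) =
      (\<Sum>i=1..n. \<Sum>j=1..n. (lp_norm p (\<lambda>k. x i k - x j k))\<^sup>2)"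
  proof (intro exI[of _ y] conjI ballI)
    fix i j assume ij: "i \<in> {1..n}" "j \<in> {1..n}"
    \<comment> \<open>The constant 3 is the rescaling bound 2 times the Lipschitz factor
      3/2.\<close>
    have "t * lp_norm 2 (\<lambda>k. mazur p (z i) k - mazur p (z j) k)
        \<le> 2 * (3 / 2 * p * lp_norm p (\<lambda>k. z i k - z j k))"
      using t mazur_lipschitz[OF p z[OF ij(1)] z[OF ij(2)]] by (intro mult_mono) (auto simp: lp_norm_nonneg)
    then show "lp_norm 2 (\<lambda>k. y i k - y j k) \<le> 3 * p * lp_norm p (\<lambda>k. x i k - x j k)"
      using yn[OF ij] by (simp add: zx)
  next
    have "(\<Sum>i=1..n. \<Sum>j=1..n. (lp_norm 2 (\<lambda>k. y i k - y j k))\<^sup>2) = t\<^sup>2 * G"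
      by (simp add: yn G_def power_mult_distrib sum_distrib_left)
    then show "(\<Sum>i=1..n. \<Sum>j=1..n. (lp_norm 2 (\<lambda>k. y i k - y j k))\<^sup>2) =
        (\<Sum>i=1..n. \<Sum>j=1..n. (lp_norm p (\<lambda>k. x i k - x j k))\<^sup>2)"
      using t by (simp add: X_def zx)
  qed (rule y)
qed simp

end
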